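(* Let $F=(F_1,\dots,F_m):\mathbb{R}^n\to\mathbb{R}^m$ be a convex map such that $\lim_{\|x\|\to\infty}F_r(x)=\infty$ for some $r\in\{1,\dots,m\}$, let $f:\mathbb{R}^n\times\mathbb{R}^m_+\to\mathbb{R}$ satisfy properties (P1)–(P4), and let $q:\mathbb{R}^n\times\mathbb{R}^n\to\mathbb{R}_+$ be a quasi-distance for which there are constants $a,b>0$ with $a\|x-y\|\le q(x,y)\le b\|x-y\|$ for all $x,y\in\mathbb{R}^n$. Let $\beta^k>0$ and $0<l<\mu^k<L$ for all $k\in\mathbb{N}$, with $l,L$ constants. Let $\{(x^k,z^k)\}_{k\in\mathbb{N}}$ be a sequence generated by the LQDPS method. Then: (i) $\{x^k\}_{k\in\mathbb{N}}$ is bounded; (ii) $\{z^k\}_{k\in\mathbb{N}}$ is convergent; (iii) $\{f(x^k,z^k)\}_{k\in\mathbb{N}}$ is nonincreasing and convergent.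
   Context: $\mathbb{N}=\{0,1,2,\dots\}$; $\mathbb{R}^m_+$ and $\mathbb{R}^m_{++}$ are the sets of vectors in $\mathbb{R}^m$ with all components $\ge 0$, respectively $>0$; $\|\cdot\|$ is the Euclidean norm. Vector inequalities $F(x)\le F(y)$ are componentwise. $F$ is convex if every component $F_i$ is convex. $e=(1,\dots,1)\in\mathbb{R}^m$; for $z,w\in\mathbb{R}^m_{++}$, $z/w$ and $\log(z/w)$ denote the vectors with components $z_i/w_i$ and $\log(z_i/w_i)$. Quasi-distance: a map $q:\mathbb{R}^n\times\mathbb{R}^n\to\mathbb{R}_+$ with $q(x,y)=q(y,x)=0\iff x=y$ and $q(x,z)\le q(x,y)+q(y,z)$ for all $x,y,z$ (symmetry is not required). Properties of $f:\mathbb{R}^n\times\mathbb{R}^m_+\to\mathbb{R}$: (P1) $f$ is bounded below: there is $\alpha\in\mathbb{R}$ with $f(x,z)\ge\alpha$ for all $(x,z)\in\mathbb{R}^n\times\mathbb{R}^m_+$. (P2) $f$ is (jointly) convex on $\mathbb{R}^n\times\mathbb{R}^m_+$. (P3) For all $x,y\in\mathbb{R}^n$ and $z\in\mathbb{R}^m_+$: if $F_i(x)\le F_i(y)$ for all $i$ then $f(x,z)\le f(y,z)$; if $F_i(x)<F_i(y)$ for all $i$ then $f(x,z)<f(y,z)$. (P4) $f$ is differentiable with respect to $z$ and $\frac{\partial}{\partial z}f(x,z)=h(x,z)$, where $h=(h_1,\dots,h_m)$ is a continuous map on $\mathbb{R}^n\times\mathbb{R}^m_+$ with values in $\mathbb{R}^m_+$.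 LQDPS method: given $x^0\in\mathbb{R}^n$, $z^0\in\mathbb{R}^m_{++}$, a sequence $\{(x^k,z^k)\}\subset\mathbb{R}^n\times\mathbb{R}^m_{++}$ is generated by the method if for every $k\in\mathbb{N}$, $(x^{k+1},z^{k+1})$ is a solution of the LQDPS problem $$\min\ \varphi^k(x,z)=f(x,z)+\beta^k\Big\langle \tfrac{z}{z^k}-\log\tfrac{z}{z^k}-e,\ e\Big\rangle+\tfrac{\mu^k}{2}q^2(x,x^k)\quad\text{subject to } x\in\Omega^k,\ z\in\mathbb{R}^m_{++},$$ where $\Omega^k=\{x\in\mathbb{R}^n: F(x)\le F(x^k)\}$. *)

theory Defs
  imports "HOL-Analysis.Analysis"
begin

definition nonneg_orthant :: "(real ^ 'm) set" where
  "nonneg_orthant = {z. \<forall>i. 0 \<le> z $ i}"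

definition pos_orthant :: "(real ^ 'm) set" where
  "pos_orthant = {z. \<forall>i. 0 < z $ i}"

definition vec_div :: "real ^ 'm \<Rightarrow> real ^ 'm \<Rightarrow> real ^ 'm" where
  "vec_div z w = (\<chi> i. z $ i / w $ i)"

definition vec_ln :: "real ^ 'm \<Rightarrow> real ^ 'm" where
  "vec_ln z = (\<chi> i. ln (z $ i))"

definition convex_map :: "(real ^ 'n \<Rightarrow> real ^ 'm) \<Rightarrow> bool" where
  "convex_map F \<longleftrightarrow> (\<forall>i. convex_on UNIV (\<lambda>x. F x $ i))"

definition quasi_distance :: "('a \<Rightarrow> 'a \<Rightarrow> real) \<Rightarrow> bool" where
  "quasi_distance q \<longleftrightarrow>
     (\<forall>x y. 0 \<le> q x y) \<and>
     (\<forall>x y. (q x y = 0 \<and> q y x = 0) \<longleftrightarrow> x = y) \<and>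
     (\<forall>x y z. q x z \<le> q x y + q y z)"

text \<open>The scalarizing function is a map on \<open>\<real>\<^sup>n \<times> \<real>\<^sup>m\<^sub>+\<close>; here it is total, and every
  property below refers to its values at \<open>z \<in> nonneg_orthant\<close> only.\<close>

definition bounded_below :: "(real ^ 'n \<Rightarrow> real ^ 'm \<Rightarrow> real) \<Rightarrow> bool" where
  "bounded_below f \<longleftrightarrow> (\<exists>\<alpha>. \<forall>x. \<forall>z\<in>nonneg_orthant. \<alpha> \<le> f x z)"

definition jointly_convex :: "(real ^ 'n \<Rightarrow> real ^ 'm \<Rightarrow> real) \<Rightarrow> bool" where
  "jointly_convex f \<longleftrightarrow> convex_on (UNIV \<times> nonneg_orthant) (\<lambda>(x, z). f x z)"

definition order_preserving ::
  "(real ^ 'n \<Rightarrow> real ^ 'm) \<Rightarrow> (real ^ 'n \<Rightarrow> real ^ 'm \<Rightarrow> real) \<Rightarrow> bool" where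
  "order_preserving F f \<longleftrightarrow>
     (\<forall>x y. \<forall>z\<in>nonneg_orthant.
        ((\<forall>i. F x $ i \<le> F y $ i) \<longrightarrow> f x z \<le> f y z) \<and>
        ((\<forall>i. F x $ i < F y $ i) \<longrightarrow> f x z < f y z))"

text \<open>At boundary points of the orthant the derivative in \<open>z\<close> is the one relative to the orthant,
  the domain of \<open>f x\<close>; \<open>h x z\<close> is the gradient.\<close>

definition nonneg_smooth_in_z :: "(real ^ 'n \<Rightarrow> real ^ 'm \<Rightarrow> real) \<Rightarrow> bool" where
  "nonneg_smooth_in_z f \<longleftrightarrow>
     (\<exists>h :: real ^ 'n \<Rightarrow> real ^ 'm \<Rightarrow> real ^ 'm.
        continuous_on (UNIV \<times> nonneg_orthant) (\<lambda>(x, z). h x z) \<and>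
        (\<forall>x. \<forall>z\<in>nonneg_orthant.
           h x z \<in> nonneg_orthant \<and>
           (f x has_derivative (\<lambda>v. h x z \<bullet> v)) (at z within nonneg_orthant)))"

definition sublevel :: "(real ^ 'n \<Rightarrow> real ^ 'm) \<Rightarrow> real ^ 'n \<Rightarrow> (real ^ 'n) set" where
  "sublevel F y = {x. \<forall>i. F x $ i \<le> F y $ i}"

text \<open>The objective of one LQDPS step at the current iterate \<open>(xk, zk)\<close>. The constant \<open>1\<close> of type
  \<open>real ^ 'm\<close> is the all-ones vector \<open>e\<close>.\<close>

definition lqdps_objective ::
  "(real ^ 'n \<Rightarrow> real ^ 'm \<Rightarrow> real) \<Rightarrow> (real ^ 'n \<Rightarrow> real ^ 'n \<Rightarrow> real) \<Rightarrow> real \<Rightarrow> real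
   \<Rightarrow> real ^ 'n \<Rightarrow> real ^ 'm \<Rightarrow> real ^ 'n \<Rightarrow> real ^ 'm \<Rightarrow> real" where
  "lqdps_objective f q b m xk zk x z =
     f x z + b * ((vec_div z zk - vec_ln (vec_div z zk) - 1) \<bullet> 1) + m / 2 * (q x xk)\<^sup>2"

definition lqdps_sequence ::
  "(real ^ 'n \<Rightarrow> real ^ 'm) \<Rightarrow> (real ^ 'n \<Rightarrow> real ^ 'm \<Rightarrow> real) \<Rightarrow> (real ^ 'n \<Rightarrow> real ^ 'n \<Rightarrow> real)
   \<Rightarrow> (nat \<Rightarrow> real) \<Rightarrow> (nat \<Rightarrow> real) \<Rightarrow> (nat \<Rightarrow> real ^ 'n) \<Rightarrow> (nat \<Rightarrow> real ^ 'm) \<Rightarrow> bool" where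
  "lqdps_sequence F f q \<beta> \<mu> x z \<longleftrightarrow>
     z 0 \<in> pos_orthant \<and>
     (\<forall>k. is_arg_min (\<lambda>(u, w). lqdps_objective f q (\<beta> k) (\<mu> k) (x k) (z k) u w)
            (\<lambda>(u, w). u \<in> sublevel F (x k) \<and> w \<in> pos_orthant)
            (x (Suc k), z (Suc k)))"

end

theory Submission
  imports Defs
begin

text \<open>Every iterate stays in the sublevel set of \<open>F\<close> at \<open>x 0\<close>, which is bounded by coercivity of
  one component. Since \<open>h\<close> is nonnegative, \<open>f\<close> is nondecreasing in \<open>z\<close>, while
  \<open>t - ln t - 1\<close> has its strict minimum at \<open>t = 1\<close>. Truncating the new iterate \<open>z (Suc k)\<close> at
  \<open>z k\<close> would therefore strictly improve the objective unless \<open>z (Suc k) \<le> z k\<close> already. So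
  \<open>z\<close> is componentwise decreasing and positive, hence convergent. Comparing the new iterate
  with the feasible point \<open>(x k, z k)\<close>, where the two regularising terms vanish, gives the descent
  of \<open>f\<close>.\<close>

text \<open>Coercivity gives a radius beyond which \<open>g\<close> exceeds \<open>c\<close>, so the
  sublevel set fits in a ball.\<close>

lemma coercive_bounded_le:
  fixes g :: "'a::real_normed_vector \<Rightarrow> real"
  assumes "filterlim g at_top at_infinity"
  shows "bounded {u. g u \<le> c}"
proof -
  have "eventually (\<lambda>u. c < g u) at_infinity"
    using assms by (simp add: filterlim_at_top_dense)
  then obtain B where B: "\<And>u. B \<le> norm u \<Longrightarrow> c < g u"
    by (auto simp: eventually_at_infinity)
  then have "norm u \<le> B" if "g u \<le> c" for u
    using that by (meson linorder_not_less nle_le)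
  then show ?thesis
    by (auto simp: bounded_iff)
qed

text \<open>By the mean value theorem on the segment from \<open>u\<close> to \<open>v\<close>, the
  increment of \<open>f x\<close> is a nonnegative gradient paired with the nonnegative vector
  \<open>v - u\<close>.\<close>

lemma nonneg_smooth_in_z_mono:
  fixes f :: "real ^ 'n \<Rightarrow> real ^ 'm \<Rightarrow> real"
  assumes "nonneg_smooth_in_z f" and "u \<in> nonneg_orthant" and "\<And>i. u $ i \<le> v $ i"
  shows "f x u \<le> f x v"
proof -
  obtain h :: "real ^ 'n \<Rightarrow> real ^ 'm \<Rightarrow> real ^ 'm"
    where h: "\<And>w. w \<in> nonneg_orthant \<Longrightarrow> h x w \<in> nonneg_orthant"
      and der: "\<And>w. w \<in> nonneg_orthant \<Longrightarrow>
        (f x has_derivative (\<lambda>v. h x w \<bullet> v)) (at w within nonneg_orthant)"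
    using assms(1) unfolding nonneg_smooth_in_z_def by blast
  define p where "p t = u + t *\<^sub>R (v - u)" for t :: real
  \<comment> \<open>As \<open>v - u\<close> is nonnegative, the segment never leaves the orthant, so
    the derivative relative to the orthant suffices for the chain rule.\<close>
  have p: "p t \<in> nonneg_orthant" if "0 \<le> t" for t
    using assms(2,3) that by (auto simp: p_def nonneg_orthant_def)
  have "((\<lambda>t. f x (p t)) has_derivative (\<lambda>s. h x (p t) \<bullet> (s *\<^sub>R (v - u)))) (at t within {0..1})"
    if "0 \<le> t" "t \<le> 1" for t
  proof (rule has_derivative_in_compose2[where t = nonneg_orthant and g = "f x" and f = p])
    show "(p has_derivative (\<lambda>s. s *\<^sub>R (v - u))) (at t within {0..1})"
      unfolding p_def by (auto intro!: derivative_eq_intros)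
  qed (use that p der in auto)
  then obtain t where t: "t \<in> {0..1}"
    and "f x (p 1) - f x (p 0) = h x (p t) \<bullet> ((1 - 0) *\<^sub>R (v - u))"
    using mvt_very_simple[of 0 1 "\<lambda>t. f x (p t)" "\<lambda>t s. h x (p t) \<bullet> (s *\<^sub>R (v - u))"] by auto
  then have "f x v - f x u = h x (p t) \<bullet> (v - u)"
    by (simp add: p_def)
  moreover have "0 \<le> h x (p t) \<bullet> (v - u)"
    using h[OF p[of t]] t assms(3)
    by (auto simp: inner_vec_def nonneg_orthant_def intro!: sum_nonneg)
  ultimately show ?thesis
    by simp
qed

lemma log_barrier_nonneg:
  fixes t :: real
  assumes "0 < t"
  shows "0 \<le> t - ln t - 1"
  using ln_le_minus_one[OF assms] by simp

text \<open>Equality in \<open>ln t \<le> t - 1\<close> occurs only at \<open>t = 1\<close>.\<close>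

lemma log_barrier_pos:
  fixes t :: real
  assumes "0 < t" and "t \<noteq> 1"
  shows "0 < t - ln t - 1"
  using log_barrier_nonneg[OF assms(1)] ln_eq_minus_one[OF assms(1)] assms(2) by linarith

text \<open>Pairing with \<open>1\<close> sums the coordinates, so the regularising term is
  separable and scalar estimates apply to each coordinate.\<close>

lemma log_barrier_vec_eq:
  fixes z w :: "real ^ 'm"
  shows "(vec_div z w - vec_ln (vec_div z w) - 1) \<bullet> 1
    = (\<Sum>i\<in>UNIV. z $ i / w $ i - ln (z $ i / w $ i) - 1)"
  by (simp add: inner_vec_def vec_div_def vec_ln_def)

lemma log_barrier_vec_nonneg:
  assumes "z \<in> pos_orthant" and "w \<in> pos_orthant"
  shows "0 \<le> (vec_div z w - vec_ln (vec_div z w) - 1) \<bullet> 1"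
  unfolding log_barrier_vec_eq
  using assms by (intro sum_nonneg log_barrier_nonneg) (auto simp: pos_orthant_def)

lemma log_barrier_vec_self:
  assumes "w \<in> pos_orthant"
  shows "(vec_div w w - vec_ln (vec_div w w) - 1) \<bullet> 1 = 0"
proof -
  have "w $ i \<noteq> 0" for i
    using assms by (auto simp: pos_orthant_def less_le)
  then show ?thesis
    unfolding log_barrier_vec_eq by simp
qed

text \<open>Coordinates with \<open>z $ j \<le> w $ j\<close> are unchanged; every other ratio
  becomes 1, where the summand takes its minimum 0. Coordinate \<open>i\<close> is of the second
  kind, which makes the drop strict.\<close>

lemma log_barrier_vec_truncate_less:
  fixes z w :: "real ^ 'm"
  assumes "z \<in> pos_orthant" and "w \<in> pos_orthant" and "w $ i < z $ i"
  defines "y \<equiv> \<chi> j. min (z $ j) (w $ j)"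
  shows "(vec_div y w - vec_ln (vec_div y w) - 1) \<bullet> 1
    < (vec_div z w - vec_ln (vec_div z w) - 1) \<bullet> 1"
  unfolding log_barrier_vec_eq
proof (rule sum_strict_mono_ex1)
  have pos: "0 < z $ j" "0 < w $ j" "w $ j \<noteq> 0" for j
    using assms(1,2) by (auto simp: pos_orthant_def less_le)
  show "\<forall>j\<in>UNIV. y $ j / w $ j - ln (y $ j / w $ j) - 1
      \<le> z $ j / w $ j - ln (z $ j / w $ j) - 1"
  proof
    fix j
    show "y $ j / w $ j - ln (y $ j / w $ j) - 1 \<le> z $ j / w $ j - ln (z $ j / w $ j) - 1"
      using log_barrier_nonneg[of "z $ j / w $ j"] pos[of j]
      by (cases "z $ j \<le> w $ j") (auto simp: y_def min_def)
  qed
  show "\<exists>j\<in>UNIV. y $ j / w $ j - ln (y $ j / w $ j) - 1 < z $ j / w $ j - ln (z $ j / w $ j) - 1"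
    using log_barrier_pos[of "z $ i / w $ i"] pos[of i] assms(3)
    by (intro bexI[of _ i]) (auto simp: y_def min_def)
qed simp

lemma decreasing_bounded_below_convergent:
  fixes z :: "nat \<Rightarrow> real ^ 'm"
  assumes "\<And>i. decseq (\<lambda>k. z k $ i)" and "\<And>k i. c \<le> z k $ i"
  shows "convergent z"
proof -
  have "\<exists>l. (\<lambda>k. z k $ i) \<longlonglongrightarrow> l" for i
    using decseq_convergent[OF assms(1), of c i] assms(2) by metis
  then obtain l where "\<And>i. (\<lambda>k. z k $ i) \<longlonglongrightarrow> l i"
    by metis
  then have "z \<longlonglongrightarrow> (\<chi> i. l i)"
    by (intro vec_tendstoI) simp
  then show ?thesis
    by (auto simp: convergent_def)
qed

theorem proposition4p4:
  fixes F :: "real ^ 'n \<Rightarrow> real ^ 'm"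
    and f :: "real ^ 'n \<Rightarrow> real ^ 'm \<Rightarrow> real"
    and q :: "real ^ 'n \<Rightarrow> real ^ 'n \<Rightarrow> real"
    and a b l L :: real
    and \<beta> \<mu> :: "nat \<Rightarrow> real"
    and x :: "nat \<Rightarrow> real ^ 'n"
    and z :: "nat \<Rightarrow> real ^ 'm"
  assumes "convex_map F"
    and "\<exists>r. filterlim (\<lambda>u. F u $ r) at_top at_infinity"
    and "bounded_below f"
    and "jointly_convex f"
    and "order_preserving F f"
    and "nonneg_smooth_in_z f"
    and "quasi_distance q"
    and "0 < a" and "0 < b"
    and "\<And>u v. a * norm (u - v) \<le> q u v \<and> q u v \<le> b * norm (u - v)"
    and "\<And>k. 0 < \<beta> k"
    and "0 < l"
    and "\<And>k. l < \<mu> k \<and> \<mu> k < L"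
    and "lqdps_sequence F f q \<beta> \<mu> x z"
  shows "bounded (range x) \<and>
         convergent z \<and>
         decseq (\<lambda>k. f (x k) (z k)) \<and> convergent (\<lambda>k. f (x k) (z k))"
proof -
  have zpos: "z k \<in> pos_orthant" for k
    using assms(14) by (cases k) (auto simp: lqdps_sequence_def is_arg_min_def)
  then have znn: "z k \<in> nonneg_orthant" for k
    by (auto simp: pos_orthant_def nonneg_orthant_def less_imp_le)
  have step: "x (Suc k) \<in> sublevel F (x k)" for k
    using assms(14) by (auto simp: lqdps_sequence_def is_arg_min_def)
  \<comment> \<open>\<open>is_arg_min\<close> only excludes feasible points of strictly smaller
    value; linearity of the order turns this into \<open>\<le>\<close>.\<close>
  have opt: "lqdps_objective f q (\<beta> k) (\<mu> k) (x k) (z k) (x (Suc k)) (z (Suc k))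
      \<le> lqdps_objective f q (\<beta> k) (\<mu> k) (x k) (z k) u w"
    if "u \<in> sublevel F (x k)" "w \<in> pos_orthant" for k u w
    using assms(14) that by (force simp: lqdps_sequence_def is_arg_min_def not_less)

  have "bounded (range x)"
  proof -
    obtain r where r: "filterlim (\<lambda>u. F u $ r) at_top at_infinity"
      using assms(2) by blast
    have "decseq (\<lambda>k. F (x k) $ r)"
      using step by (auto simp: decseq_Suc_iff sublevel_def)
    then have "range x \<subseteq> {u. F u $ r \<le> F (x 0) $ r}"
      by (auto simp: decseq_def)
    then show ?thesis
      using coercive_bounded_le[OF r] bounded_subset by blast
  qed

  moreover have "convergent z"
  proof (rule decreasing_bounded_below_convergent)
    have "z (Suc k) $ i \<le> z k $ i" for k i
    proof (rule ccontr)
      assume less: "\<not> z (Suc k) $ i \<le> z k $ i"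
      \<comment> \<open>Truncation leaves \<open>x (Suc k)\<close> alone, so the candidate stays
        feasible and the \<open>q\<close> term is the same for both points.\<close>
      define y where "y = (\<chi> j. min (z (Suc k) $ j) (z k $ j))"
      have ypos: "y \<in> pos_orthant"
        using zpos by (auto simp: y_def pos_orthant_def)
      then have "f (x (Suc k)) y \<le> f (x (Suc k)) (z (Suc k))"
        by (intro nonneg_smooth_in_z_mono[OF assms(6)])
          (auto simp: y_def pos_orthant_def nonneg_orthant_def less_imp_le)
      moreover have "(vec_div y (z k) - vec_ln (vec_div y (z k)) - 1) \<bullet> 1
          < (vec_div (z (Suc k)) (z k) - vec_ln (vec_div (z (Suc k)) (z k)) - 1) \<bullet> 1"
        unfolding y_def using less by (intro log_barrier_vec_truncate_less[where i = i] zpos) simp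
      ultimately have "lqdps_objective f q (\<beta> k) (\<mu> k) (x k) (z k) (x (Suc k)) y
          < lqdps_objective f q (\<beta> k) (\<mu> k) (x k) (z k) (x (Suc k)) (z (Suc k))"
        unfolding lqdps_objective_def
        using assms(11) by (intro add_strict_right_mono add_le_less_mono mult_strict_left_mono)
      then show False
        using opt[OF step ypos] by (simp add: not_less[symmetric])
    qed
    then show "decseq (\<lambda>k. z k $ i)" for i
      by (simp add: decseq_Suc_iff)
    \<comment> \<open>Positivity enters only as the bound 0, which places the limit in the closed
      orthant.\<close>
    show "0 \<le> z k $ i" for k i
      using znn by (auto simp: nonneg_orthant_def)
  qed

  moreover have dec: "decseq (\<lambda>k. f (x k) (z k))"
    unfolding decseq_Suc_iff
  proof
    fix k
    have "q (x k) (x k) = 0"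
      using assms(7) by (auto simp: quasi_distance_def)
    then have "lqdps_objective f q (\<beta> k) (\<mu> k) (x k) (z k) (x k) (z k) = f (x k) (z k)"
      by (simp add: lqdps_objective_def log_barrier_vec_self[OF zpos])
    \<comment> \<open>Both regularising terms are nonnegative, since \<open>0 < \<beta> k\<close>
      and \<open>0 < l < \<mu> k\<close>, so dropping them can only lower the objective.\<close>
    moreover have "f (x (Suc k)) (z (Suc k))
        \<le> lqdps_objective f q (\<beta> k) (\<mu> k) (x k) (z k) (x (Suc k)) (z (Suc k))"
    proof -
      have "0 \<le> \<mu> k / 2 * (q (x (Suc k)) (x k))\<^sup>2"
        using assms(12) assms(13)[of k] by simp
      moreover have "0 \<le> \<beta> k * ((vec_div (z (Suc k)) (z k) -
          vec_ln (vec_div (z (Suc k)) (z k)) - 1) \<bullet> 1)"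
        using assms(11)[of k] log_barrier_vec_nonneg[OF zpos zpos]
        by (intro mult_nonneg_nonneg) auto
      ultimately show ?thesis
        by (simp add: lqdps_objective_def)
    qed
    moreover have "x k \<in> sublevel F (x k)"
      by (simp add: sublevel_def)
    ultimately show "f (x (Suc k)) (z (Suc k)) \<le> f (x k) (z k)"
      using opt[of "x k" k "z k"] zpos by fastforce
  qed

  moreover have "convergent (\<lambda>k. f (x k) (z k))"
  proof -
    \<comment> \<open>The lower bound of \<open>f\<close> holds over the closed orthant, which
      contains every \<open>z k\<close>.\<close>
    obtain \<alpha> where "\<And>k. \<alpha> \<le> f (x k) (z k)"
      using assms(3) znn by (auto simp: bounded_below_def)
    then show ?thesis
      using decseq_convergent[OF dec] by (metis convergent_def)
  qed

  ultimately show ?thesis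
    by blast
qed

end
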